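(* Let $\kappa\in\mathbb{R}$, let $f$ be an almost periodic function in $\mathbb{C}_\kappa=\{s=\sigma+it:\sigma>\kappa\}$, and let $\tau>0$. Then the limit \[P_\tau f(s)=\lim_{k\to\infty}\frac1k\sum_{j=0}^{k-1}V_{j\tau}f(s)\] converges uniformly in the strip $\mathbb{S}_{\alpha,\beta}=\{s=\sigma+it:\alpha<\sigma<\beta\}$ for all real $\alpha,\beta$ with $\kappa<\alpha<\beta$. Moreover, $V_\tau P_\tau f(s)=P_\tau f(s)$ for all $s\in\mathbb{C}_\kappa$, so that $P_\tau f$ is periodic in $\mathbb{C}_\kappa$ with period at most $\tau$ (that is, $\tau$ itself is a period of $P_\tau f$).
   Context: For real $\tau$, the vertical translation is $V_\tau f(s)=f(s+i\tau)$. A real number $\tau$ is a translation number of a complex-valued function $f$ on $\mathbb{C}_\kappa$ belonging to $\varepsilon>0$ if $|V_\tau f(s)-f(s)|\le\varepsilon$ for all $s\in\mathbb{C}_\kappa$; $E_f(\varepsilon)$ denotes the set of all such $\tau$. A set of real numbers is relatively dense if there is $L>0$ such that the set has non-empty intersection with every interval of length $L$. A continuous function $f$ on $\mathbb{C}_\kappa$ is almost periodic in $\mathbb{C}_\kappa$ if $E_f(\varepsilon)$ is relatively dense for every $\varepsilon>0$. (Analyticity of $f$ is not assumed.) *)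

theory Defs
  imports "HOL-Analysis.Analysis"
begin

definition half_plane :: "real \<Rightarrow> complex set" where
  "half_plane \<kappa> = {s. Re s > \<kappa>}"

definition strip :: "real \<Rightarrow> real \<Rightarrow> complex set" where
  "strip \<alpha> \<beta> = {s. \<alpha> < Re s \<and> Re s < \<beta>}"

text \<open>
  A function on a half-plane is represented by a total function on the complex numbers. Half-planes
  and strips are invariant under vertical translation, so the values outside never matter.
\<close>

definition vtrans :: "real \<Rightarrow> (complex \<Rightarrow> complex) \<Rightarrow> complex \<Rightarrow> complex" where
  "vtrans \<tau> f s = f (s + \<i> * complex_of_real \<tau>)"

definition translation_numbers :: "real \<Rightarrow> (complex \<Rightarrow> complex) \<Rightarrow> real \<Rightarrow> real set" where
  "translation_numbers \<kappa> f \<epsilon> = {\<tau>. \<forall>s\<in>half_plane \<kappa>. cmod (vtrans \<tau> f s - f s) \<le> \<epsilon>}"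

definition relatively_dense :: "real set \<Rightarrow> bool" where
  "relatively_dense A \<longleftrightarrow> (\<exists>L>0. \<forall>a. A \<inter> {a..a + L} \<noteq> {})"

definition almost_periodic :: "real \<Rightarrow> (complex \<Rightarrow> complex) \<Rightarrow> bool" where
  "almost_periodic \<kappa> f \<longleftrightarrow>
     continuous_on (half_plane \<kappa>) f \<and>
     (\<forall>\<epsilon>>0. relatively_dense (translation_numbers \<kappa> f \<epsilon>))"

text \<open>For \<open>k = 0\<close> the mean below is \<open>0\<close>, which is irrelevant for the limit.\<close>

definition vmean :: "real \<Rightarrow> (complex \<Rightarrow> complex) \<Rightarrow> nat \<Rightarrow> complex \<Rightarrow> complex" where
  "vmean \<tau> f k s = (1 / of_nat k) * (\<Sum>j<k. vtrans (real j * \<tau>) f s)"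

definition vproj :: "real \<Rightarrow> (complex \<Rightarrow> complex) \<Rightarrow> complex \<Rightarrow> complex" where
  "vproj \<tau> f s = lim (\<lambda>k. vmean \<tau> f k s)"

text \<open>Periods refer to the vertical direction, and need not be minimal.\<close>

definition vertical_period :: "real \<Rightarrow> (complex \<Rightarrow> complex) \<Rightarrow> real \<Rightarrow> bool" where
  "vertical_period \<kappa> f p \<longleftrightarrow> p > 0 \<and> (\<forall>s\<in>half_plane \<kappa>. f (s + \<i> * complex_of_real p) = f s)"

end

theory Submission
  imports Defs
begin

text \<open>
  This is a mean ergodic theorem for the vertical translation \<open>V\<^sub>\<tau>\<close>, and it holds because the
  orbit \<open>V\<^bsub>j\<tau>\<^esub> f\<close> is totally bounded for the supremum norm on a strip.

  Total boundedness comes from almost periodicity (lemma \<open>finite_orbit_approximation\<close>). A vertical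
  shift by \<open>n\<tau>\<close> equals, up to \<open>\<epsilon>\<close>, a shift by some \<open>u\<close> in a fixed interval \<open>[0, L]\<close>, since a
  translation number can be subtracted. As \<open>f\<close> is uniformly continuous in the vertical direction
  on the strip, the interval splits into finitely many pieces on which the shift hardly varies. So
  every \<open>V\<^bsub>n\<tau>\<^esub> f\<close> is uniformly close to some \<open>V\<^bsub>r\<tau>\<^esub> f\<close> with \<open>r \<le> R\<close>, for a fixed \<open>R\<close>.

  Let \<open>A\<^sub>k\<close> be the mean of the first \<open>k\<close> translates. If \<open>f\<close> is bounded by \<open>M\<close> on the strip, then
  shifting \<open>A\<^sub>k\<close> by \<open>r \<le> R\<close> steps moves it by at most \<open>2RM/k\<close>, because only the terms at the two
  ends change. Hence shifting \<open>A\<^sub>k\<close> by any number \<open>n\<close> of steps moves it by at most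
  \<open>\<epsilon> + 2RM/k\<close>, and so does averaging it over its first \<open>m\<close> shifts. That double average is
  symmetric in \<open>k\<close> and \<open>m\<close>, so the distance from \<open>A\<^sub>k\<close> to \<open>A\<^sub>m\<close> is at most
  \<open>2\<epsilon> + 2RM/k + 2RM/m\<close> (lemma \<open>norm_scaled_partial_sums_diff_le\<close>), uniformly on the strip. The
  means are therefore uniformly Cauchy, and the one-step shift estimate makes the limit invariant.
\<close>

section \<open>Means of sequences with a totally bounded orbit\<close>

lemma sum_lessThan_add:
  fixes x :: "nat \<Rightarrow> 'a::comm_monoid_add"
  shows "(\<Sum>j<m + n. x j) = (\<Sum>j<m. x j) + (\<Sum>j<n. x (m + j))"
  by (induction n) (simp_all add: add.assoc)

text \<open>Two windows of equal length differ only by the \<open>r\<close> terms that leave and the \<open>r\<close> that enter.\<close>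

lemma norm_sum_shift_le:
  fixes x :: "nat \<Rightarrow> 'a::real_normed_vector"
  assumes "\<And>n. norm (x n) \<le> M"
  shows "norm ((\<Sum>j<k. x (r + j)) - (\<Sum>j<k. x j)) \<le> 2 * real r * M"
proof -
  have "(\<Sum>j<k. x (r + j)) - (\<Sum>j<k. x j) = (\<Sum>j<r. x (k + j)) - (\<Sum>j<r. x j)"
    using sum_lessThan_add[of x r k] sum_lessThan_add[of x k r] unfolding add.commute[of k r]
    by (simp add: algebra_simps)
  moreover have "norm (\<Sum>j<r. x (k + j)) \<le> real r * M" "norm (\<Sum>j<r. x j) \<le> real r * M"
    using sum_norm_bound[of "{..<r}" "\<lambda>j. x (k + j)" M] sum_norm_bound[of "{..<r}" x M] assms
    by auto
  ultimately show ?thesis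
    using norm_triangle_ineq4[of "\<Sum>j<r. x (k + j)" "\<Sum>j<r. x j"] by simp
qed

text \<open>
  The estimate for the distance of two means, multiplied by \<open>k * m\<close> to avoid division. Both
  \<open>m\<close> times the sum of length \<open>k\<close> and \<open>k\<close> times the sum of length \<open>m\<close> are compared with the
  double sum of \<open>x (n + j)\<close> over \<open>n < m\<close> and \<open>j < k\<close>.
\<close>

lemma norm_scaled_partial_sums_diff_le:
  fixes x :: "nat \<Rightarrow> 'a::real_normed_vector"
  assumes bound: "\<And>n. norm (x n) \<le> M"
    and net: "\<And>n. \<exists>r\<le>R. \<forall>j. norm (x (n + j) - x (r + j)) \<le> \<epsilon>"
  shows "norm (real m *\<^sub>R (\<Sum>j<k. x j) - real k *\<^sub>R (\<Sum>j<m. x j))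
           \<le> 2 * real k * real m * \<epsilon> + 2 * real R * M * (real k + real m)"
proof -
  have "0 \<le> M"
    using bound[of 0] norm_ge_zero order_trans by blast
  have shift: "norm ((\<Sum>j<k. x (n + j)) - (\<Sum>j<k. x j)) \<le> real k * \<epsilon> + 2 * real R * M" for n k
  proof -
    obtain r where "r \<le> R" and r: "\<And>j. norm (x (n + j) - x (r + j)) \<le> \<epsilon>"
      using net by blast
    have "norm (\<Sum>j<k. x (n + j) - x (r + j)) \<le> real k * \<epsilon>"
      using sum_norm_bound[of "{..<k}" "\<lambda>j. x (n + j) - x (r + j)" \<epsilon>] r by simp
    moreover have "norm ((\<Sum>j<k. x (r + j)) - (\<Sum>j<k. x j)) \<le> 2 * real r * M"
      by (rule norm_sum_shift_le) (rule bound)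
    moreover have "2 * real r * M \<le> 2 * real R * M"
      using \<open>r \<le> R\<close> \<open>0 \<le> M\<close> by (simp add: mult_right_mono)
    moreover have "(\<Sum>j<k. x (n + j)) - (\<Sum>j<k. x j)
        = (\<Sum>j<k. x (n + j) - x (r + j)) + ((\<Sum>j<k. x (r + j)) - (\<Sum>j<k. x j))"
      by (simp add: sum_subtractf)
    ultimately show ?thesis
      by (simp only:) (intro norm_triangle_le, linarith)
  qed
  have average: "norm ((\<Sum>n<m. \<Sum>j<k. x (n + j)) - real m *\<^sub>R (\<Sum>j<k. x j))
      \<le> real m * (real k * \<epsilon> + 2 * real R * M)" for k m
  proof -
    have "(\<Sum>n<m. \<Sum>j<k. x (n + j)) - real m *\<^sub>R (\<Sum>j<k. x j)
        = (\<Sum>n<m. (\<Sum>j<k. x (n + j)) - (\<Sum>j<k. x j))"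
      by (simp add: sum_subtractf sum_constant_scaleR)
    then show ?thesis
      using sum_norm_bound[of "{..<m}" "\<lambda>n. (\<Sum>j<k. x (n + j)) - (\<Sum>j<k. x j)"
          "real k * \<epsilon> + 2 * real R * M"] shift
      by simp
  qed
  have "(\<Sum>n<m. \<Sum>j<k. x (n + j)) = (\<Sum>n<k. \<Sum>j<m. x (n + j))"
    by (subst sum.swap) (simp add: add.commute)
  then have "norm (real m *\<^sub>R (\<Sum>j<k. x j) - real k *\<^sub>R (\<Sum>j<m. x j))
      \<le> real m * (real k * \<epsilon> + 2 * real R * M) + real k * (real m * \<epsilon> + 2 * real R * M)"
    using average[where k = k and m = m] average[where k = m and m = k]
      norm_triangle_ineq4[of "(\<Sum>n<k. \<Sum>j<m. x (n + j)) - real k *\<^sub>R (\<Sum>j<m. x j)"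
        "(\<Sum>n<k. \<Sum>j<m. x (n + j)) - real m *\<^sub>R (\<Sum>j<k. x j)"]
    by simp
  then show ?thesis
    by (simp add: algebra_simps)
qed

section \<open>Almost periodic functions on a strip\<close>

lemma strip_add_imaginary [simp]:
  "s + \<i> * complex_of_real t \<in> strip \<alpha> \<beta> \<longleftrightarrow> s \<in> strip \<alpha> \<beta>"
  by (simp add: strip_def)

lemma strip_subset_half_plane:
  "\<kappa> < \<alpha> \<Longrightarrow> strip \<alpha> \<beta> \<subseteq> half_plane \<kappa>"
  by (auto simp: strip_def half_plane_def)

lemma almost_periodic_translation_in_interval:
  assumes "almost_periodic \<kappa> f" "\<epsilon> > 0"
  obtains L where
    "\<And>a. \<exists>\<rho>\<in>{a..a + L}. \<forall>s\<in>half_plane \<kappa>. cmod (f (s + \<i> * complex_of_real \<rho>) - f s) \<le> \<epsilon>"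
proof -
  obtain L where "\<And>a. translation_numbers \<kappa> f \<epsilon> \<inter> {a..a + L} \<noteq> {}"
    using assms unfolding almost_periodic_def relatively_dense_def by blast
  then show thesis
    unfolding translation_numbers_def vtrans_def by (intro that[of L]) blast+
qed

lemma compact_rectangle_in_half_plane:
  assumes "almost_periodic \<kappa> f" "\<kappa> < \<alpha>"
  shows "compact (cbox (Complex \<alpha> a) (Complex \<beta> b))"
    and "continuous_on (cbox (Complex \<alpha> a) (Complex \<beta> b)) f"
proof -
  have "cbox (Complex \<alpha> a) (Complex \<beta> b) \<subseteq> half_plane \<kappa>"
    using assms(2) by (auto simp: half_plane_def in_cbox_complex_iff)
  then show "continuous_on (cbox (Complex \<alpha> a) (Complex \<beta> b)) f"
    using assms(1) continuous_on_subset unfolding almost_periodic_def by blast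
qed (rule compact_cbox)

text \<open>
  A suitable translation number moves any given point of the strip into a fixed compact rectangle
  and changes the value of \<open>f\<close> by at most \<open>1\<close>, so boundedness on the rectangle is enough. The next
  lemma transfers uniform continuity in the same way.
\<close>

lemma almost_periodic_bounded_on_strip:
  assumes ap: "almost_periodic \<kappa> f" and "\<kappa> < \<alpha>"
  obtains M where "\<And>s. s \<in> strip \<alpha> \<beta> \<Longrightarrow> cmod (f s) \<le> M"
proof -
  obtain L where L: "\<And>a. \<exists>\<rho>\<in>{a..a + L}. \<forall>s\<in>half_plane \<kappa>.
      cmod (f (s + \<i> * complex_of_real \<rho>) - f s) \<le> 1"
    using almost_periodic_translation_in_interval[OF ap zero_less_one] by metis
  define K where "K = cbox (Complex \<alpha> 0) (Complex \<beta> L)"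
  have "bounded (f ` K)"
    using compact_rectangle_in_half_plane[OF ap \<open>\<kappa> < \<alpha>\<close>] unfolding K_def
    by (blast intro: compact_imp_bounded compact_continuous_image)
  then obtain B where B: "\<And>z. z \<in> K \<Longrightarrow> cmod (f z) \<le> B"
    unfolding bounded_iff by blast
  have "cmod (f s) \<le> B + 1" if s: "s \<in> strip \<alpha> \<beta>" for s
  proof -
    obtain \<rho> where \<rho>: "- Im s \<le> \<rho>" "\<rho> \<le> - Im s + L"
      and "\<forall>s\<in>half_plane \<kappa>. cmod (f (s + \<i> * complex_of_real \<rho>) - f s) \<le> 1"
      using L[of "- Im s"] by auto
    then have "cmod (f (s + \<i> * complex_of_real \<rho>) - f s) \<le> 1"
      using s strip_subset_half_plane[OF \<open>\<kappa> < \<alpha>\<close>] by blast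
    moreover have "cmod (f (s + \<i> * complex_of_real \<rho>)) \<le> B"
      using s \<rho> by (intro B) (auto simp: K_def in_cbox_complex_iff strip_def)
    ultimately show ?thesis
      using norm_triangle_ineq4[of "f (s + \<i> * complex_of_real \<rho>)"
          "f (s + \<i> * complex_of_real \<rho>) - f s"] by simp
  qed
  then show thesis
    by (rule that)
qed

lemma almost_periodic_vertically_uniformly_continuous:
  assumes ap: "almost_periodic \<kappa> f" and "\<kappa> < \<alpha>" and "\<epsilon> > 0"
  obtains \<delta> where "\<delta> > 0"
    and "\<And>s h. s \<in> strip \<alpha> \<beta> \<Longrightarrow> \<bar>h\<bar> < \<delta> \<Longrightarrow> cmod (f (s + \<i> * complex_of_real h) - f s) \<le> 3 * \<epsilon>"
proof -
  obtain L where L: "\<And>a. \<exists>\<rho>\<in>{a..a + L}. \<forall>s\<in>half_plane \<kappa>.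
      cmod (f (s + \<i> * complex_of_real \<rho>) - f s) \<le> \<epsilon>"
    using almost_periodic_translation_in_interval[OF ap \<open>\<epsilon> > 0\<close>] by metis
  \<comment> \<open>The margin \<open>1\<close> above and below leaves room for the increment \<open>h\<close>.\<close>
  define K where "K = cbox (Complex \<alpha> (-1)) (Complex \<beta> (L + 1))"
  have "uniformly_continuous_on K f"
    using compact_rectangle_in_half_plane[OF ap \<open>\<kappa> < \<alpha>\<close>] unfolding K_def
    by (blast intro: compact_uniformly_continuous)
  then obtain d where "d > 0"
    and d: "\<And>z w. z \<in> K \<Longrightarrow> w \<in> K \<Longrightarrow> dist w z < d \<Longrightarrow> dist (f w) (f z) < \<epsilon>"
    unfolding uniformly_continuous_on_def using \<open>\<epsilon> > 0\<close> by metis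
  have "cmod (f (s + \<i> * complex_of_real h) - f s) \<le> 3 * \<epsilon>"
    if s: "s \<in> strip \<alpha> \<beta>" and h: "\<bar>h\<bar> < min d 1" for s h
  proof -
    obtain \<rho> where \<rho>: "- Im s \<le> \<rho>" "\<rho> \<le> - Im s + L"
      and trans: "\<forall>s\<in>half_plane \<kappa>. cmod (f (s + \<i> * complex_of_real \<rho>) - f s) \<le> \<epsilon>"
      using L[of "- Im s"] by auto
    define z where "z = s + \<i> * complex_of_real \<rho>"
    define w where "w = s + \<i> * complex_of_real h + \<i> * complex_of_real \<rho>"
    have "s \<in> half_plane \<kappa>" "s + \<i> * complex_of_real h \<in> half_plane \<kappa>"
      using s strip_subset_half_plane[OF \<open>\<kappa> < \<alpha>\<close>] strip_add_imaginary by blast+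
    then have "cmod (f z - f s) \<le> \<epsilon>" "cmod (f w - f (s + \<i> * complex_of_real h)) \<le> \<epsilon>"
      using trans unfolding z_def w_def by blast+
    moreover have "cmod (f w - f z) < \<epsilon>"
    proof -
      have "z \<in> K" "w \<in> K"
        using s h \<rho> by (auto simp: z_def w_def K_def in_cbox_complex_iff strip_def)
      moreover have "dist w z < d"
        using h by (simp add: z_def w_def dist_norm norm_mult)
      ultimately show ?thesis
        using d by (simp add: dist_norm)
    qed
    ultimately show ?thesis
      using norm_triangle_ineq4[of "f w - f s" "f w - f (s + \<i> * complex_of_real h)"]
        norm_triangle_ineq[of "f w - f z" "f z - f s"]
      by simp
  qed
  then show thesis
    using \<open>d > 0\<close> by (intro that[of "min d 1"]) auto
qed

text \<open>
  A pigeonhole argument: sort the numbers \<open>n\<close> by the piece of length \<open>\<delta>\<close> of \<open>[0, L]\<close> that contains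
  the reduced shift \<open>n\<tau> - \<rho>\<close>. There are finitely many pieces, so finitely many \<open>n\<close> represent all
  that occur. As the strip is invariant under vertical translation, the conclusion for \<open>n\<close> and \<open>r\<close>
  carries over to \<open>n + j\<close> and \<open>r + j\<close>, which is the form that the estimate for means requires.
\<close>

lemma finite_orbit_approximation:
  assumes ap: "almost_periodic \<kappa> f" and "\<kappa> < \<alpha>" and "\<epsilon> > 0"
  obtains R :: nat where
    "\<And>n. \<exists>r\<le>R. \<forall>s\<in>strip \<alpha> \<beta>. cmod (vtrans (real n * \<tau>) f s - vtrans (real r * \<tau>) f s) \<le> 5 * \<epsilon>"
proof -
  obtain L where L: "\<And>a. \<exists>\<rho>\<in>{a..a + L}. \<forall>s\<in>half_plane \<kappa>.
      cmod (f (s + \<i> * complex_of_real \<rho>) - f s) \<le> \<epsilon>"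
    using almost_periodic_translation_in_interval[OF ap \<open>\<epsilon> > 0\<close>] by metis
  obtain \<delta> where "\<delta> > 0" and \<delta>: "\<And>s h. s \<in> strip \<alpha> \<beta> \<Longrightarrow> \<bar>h\<bar> < \<delta> \<Longrightarrow>
      cmod (f (s + \<i> * complex_of_real h) - f s) \<le> 3 * \<epsilon>"
    using almost_periodic_vertically_uniformly_continuous[OF assms, of \<beta>] by metis
  have "\<exists>u\<in>{0..L}. \<forall>s\<in>strip \<alpha> \<beta>.
      cmod (vtrans (real n * \<tau>) f s - f (s + \<i> * complex_of_real u)) \<le> \<epsilon>" for n
  proof -
    obtain \<rho> where \<rho>: "\<rho> \<in> {real n * \<tau> - L..real n * \<tau>}"
      and trans: "\<forall>s\<in>half_plane \<kappa>. cmod (f (s + \<i> * complex_of_real \<rho>) - f s) \<le> \<epsilon>"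
      using L[of "real n * \<tau> - L"] by auto
    have "cmod (vtrans (real n * \<tau>) f s - f (s + \<i> * complex_of_real (real n * \<tau> - \<rho>))) \<le> \<epsilon>"
      if "s \<in> strip \<alpha> \<beta>" for s
    proof -
      have "s + \<i> * complex_of_real (real n * \<tau> - \<rho>) \<in> half_plane \<kappa>"
        using that strip_subset_half_plane[OF \<open>\<kappa> < \<alpha>\<close>] strip_add_imaginary by blast
      from trans[rule_format, OF this] show ?thesis
        by (simp add: vtrans_def algebra_simps)
    qed
    then show ?thesis
      using \<rho> by (intro bexI[of _ "real n * \<tau> - \<rho>"]) auto
  qed
  then obtain u where u: "\<And>n. u n \<in> {0..L}" and close: "\<And>n s. s \<in> strip \<alpha> \<beta> \<Longrightarrow>
      cmod (vtrans (real n * \<tau>) f s - f (s + \<i> * complex_of_real (u n))) \<le> \<epsilon>"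
    by metis
  define piece where "piece n = \<lfloor>u n / \<delta>\<rfloor>" for n
  have "range piece \<subseteq> {0..\<lfloor>L / \<delta>\<rfloor>}"
    using u \<open>\<delta> > 0\<close> by (auto simp: piece_def intro!: floor_mono divide_right_mono)
  then have "finite (range piece)"
    using finite_subset by blast
  then obtain C where "finite C" and C: "range piece = piece ` C"
    using finite_subset_image[of "range piece" piece UNIV] by auto
  obtain R where R: "\<And>r. r \<in> C \<Longrightarrow> r \<le> R"
    using \<open>finite C\<close> finite_nat_set_iff_bounded_le by auto
  have "\<exists>r\<le>R. \<forall>s\<in>strip \<alpha> \<beta>.
      cmod (vtrans (real n * \<tau>) f s - vtrans (real r * \<tau>) f s) \<le> 5 * \<epsilon>" for n
  proof -
    have "piece n \<in> piece ` C"
      using C by blast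
    then obtain r where "r \<in> C" and same: "piece n = piece r"
      by blast
    have "\<bar>u n / \<delta> - u r / \<delta>\<bar> < 1"
      using same unfolding piece_def by linarith
    then have near: "\<bar>u n - u r\<bar> < \<delta>"
      using \<open>\<delta> > 0\<close> by (simp add: abs_less_iff field_simps)
    have "cmod (vtrans (real n * \<tau>) f s - vtrans (real r * \<tau>) f s) \<le> 5 * \<epsilon>"
      if s: "s \<in> strip \<alpha> \<beta>" for s
    proof -
      have "cmod (f (s + \<i> * complex_of_real (u n)) - f (s + \<i> * complex_of_real (u r))) \<le> 3 * \<epsilon>"
        using \<delta>[of "s + \<i> * complex_of_real (u r)" "u n - u r"] s near
        by (simp add: algebra_simps)
      then show ?thesis
        using close[OF s, of n] close[OF s, of r]
          norm_triangle_ineq[of "vtrans (real n * \<tau>) f s - f (s + \<i> * complex_of_real (u n))"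
            "f (s + \<i> * complex_of_real (u n)) - f (s + \<i> * complex_of_real (u r))"]
          norm_triangle_ineq4[of "vtrans (real n * \<tau>) f s - f (s + \<i> * complex_of_real (u r))"
            "vtrans (real r * \<tau>) f s - f (s + \<i> * complex_of_real (u r))"]
        by simp
    qed
    then show ?thesis
      using R \<open>r \<in> C\<close> by blast
  qed
  then show thesis
    by (rule that)
qed

section \<open>Convergence of the means\<close>

lemma vtrans_vtrans_nat_multiple:
  "vtrans (real n * \<tau>) f (s + \<i> * complex_of_real (real j * \<tau>)) = vtrans (real (n + j) * \<tau>) f s"
  by (simp add: vtrans_def algebra_simps)

lemma vmean_uniformly_convergent_on_strip:
  assumes ap: "almost_periodic \<kappa> f" and "\<kappa> < \<alpha>"
  shows "uniformly_convergent_on (strip \<alpha> \<beta>) (vmean \<tau> f)"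
proof (intro Cauchy_uniformly_convergent uniformly_Cauchy_onI)
  fix e :: real
  assume "e > 0"
  \<comment> \<open>The final bound is \<open>10 * \<epsilon> + c / k + c / m\<close>; each summand is to be below \<open>e / 3\<close>.\<close>
  define \<epsilon> where "\<epsilon> = e / 40"
  have "\<epsilon> > 0"
    using \<open>e > 0\<close> by (simp add: \<epsilon>_def)
  obtain M where M: "\<And>s. s \<in> strip \<alpha> \<beta> \<Longrightarrow> cmod (f s) \<le> M"
    using almost_periodic_bounded_on_strip[OF assms] by metis
  obtain R :: nat where R: "\<And>n. \<exists>r\<le>R. \<forall>s\<in>strip \<alpha> \<beta>.
      cmod (vtrans (real n * \<tau>) f s - vtrans (real r * \<tau>) f s) \<le> 5 * \<epsilon>"
    using finite_orbit_approximation[OF assms \<open>\<epsilon> > 0\<close>] by metis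
  define c where "c = 2 * real R * M"
  have "(\<lambda>k. c / real k) \<longlonglongrightarrow> 0"
    by (rule lim_const_over_n)
  then have "\<forall>\<^sub>F k in sequentially. c / real k < e / 3"
    using \<open>e > 0\<close> by (intro order_tendstoD(2)) auto
  then obtain N where N: "\<And>k. k \<ge> N \<Longrightarrow> c / real k < e / 3"
    unfolding eventually_sequentially by blast
  have "dist (vmean \<tau> f m s) (vmean \<tau> f k s) < e"
    if s: "s \<in> strip \<alpha> \<beta>" and "m \<ge> max N 1" "k \<ge> max N 1" for s m k
  proof -
    have "k > 0" "m > 0"
      using that by auto
    define x where "x j = vtrans (real j * \<tau>) f s" for j
    have "cmod (x n) \<le> M" for n
      unfolding x_def vtrans_def using s by (intro M) (simp only: strip_add_imaginary)
    moreover have "\<exists>r\<le>R. \<forall>j. cmod (x (n + j) - x (r + j)) \<le> 5 * \<epsilon>" for n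
    proof -
      obtain r where "r \<le> R" and r: "\<forall>s\<in>strip \<alpha> \<beta>.
          cmod (vtrans (real n * \<tau>) f s - vtrans (real r * \<tau>) f s) \<le> 5 * \<epsilon>"
        using R by blast
      have "cmod (x (n + j) - x (r + j)) \<le> 5 * \<epsilon>" for j
        using r[rule_format, of "s + \<i> * complex_of_real (real j * \<tau>)"] s
        by (simp only: x_def vtrans_vtrans_nat_multiple strip_add_imaginary)
      then show ?thesis
        using \<open>r \<le> R\<close> by blast
    qed
    ultimately have "cmod (real m *\<^sub>R (\<Sum>j<k. x j) - real k *\<^sub>R (\<Sum>j<m. x j))
        \<le> 2 * real k * real m * (5 * \<epsilon>) + 2 * real R * M * (real k + real m)"
      by (rule norm_scaled_partial_sums_diff_le)
    moreover have "vmean \<tau> f k s = (\<Sum>j<k. x j) / of_nat k" for k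
      by (simp add: vmean_def x_def)
    then have "real m *\<^sub>R (\<Sum>j<k. x j) - real k *\<^sub>R (\<Sum>j<m. x j)
        = of_nat (k * m) * (vmean \<tau> f k s - vmean \<tau> f m s)"
      using \<open>k > 0\<close> \<open>m > 0\<close>
      by (simp add: scaleR_conv_of_real field_simps)
    ultimately have "real (k * m) * cmod (vmean \<tau> f k s - vmean \<tau> f m s)
        \<le> 10 * (real k * real m) * \<epsilon> + c * (real k + real m)"
      by (simp only: norm_mult norm_of_nat c_def)
    also have "\<dots> = real (k * m) * (10 * \<epsilon> + c / real k + c / real m)"
      using \<open>k > 0\<close> \<open>m > 0\<close> by (simp add: field_simps)
    finally have "cmod (vmean \<tau> f k s - vmean \<tau> f m s) \<le> 10 * \<epsilon> + c / real k + c / real m"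
      using \<open>k > 0\<close> \<open>m > 0\<close> by simp
    moreover have "10 * \<epsilon> < e / 3" "c / real k < e / 3" "c / real m < e / 3"
      using \<open>e > 0\<close> N that by (auto simp: \<epsilon>_def)
    ultimately show ?thesis
      unfolding dist_norm norm_minus_commute[of "vmean \<tau> f m s"] by linarith
  qed
  then show "\<exists>M. \<forall>s\<in>strip \<alpha> \<beta>. \<forall>m\<ge>M. \<forall>k\<ge>M. dist (vmean \<tau> f m s) (vmean \<tau> f k s) < e"
    by blast
qed

text \<open>One step of translation changes the mean of \<open>k\<close> terms by \<open>O(1/k)\<close>, so the limits agree.\<close>

lemma vproj_invariant:
  assumes ap: "almost_periodic \<kappa> f" and s: "s \<in> half_plane \<kappa>"
  shows "vtrans \<tau> (vproj \<tau> f) s = vproj \<tau> f s"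
proof -
  obtain \<alpha> where "\<kappa> < \<alpha>" "\<alpha> < Re s"
    using s dense unfolding half_plane_def by blast
  define S where "S = strip \<alpha> (Re s + 1)"
  have "s \<in> S" and s': "s + \<i> * complex_of_real \<tau> \<in> S"
    using \<open>\<alpha> < Re s\<close> by (auto simp: S_def strip_def)
  obtain M where M: "\<And>z. z \<in> S \<Longrightarrow> cmod (f z) \<le> M"
    using almost_periodic_bounded_on_strip[OF ap \<open>\<kappa> < \<alpha>\<close>] unfolding S_def by metis
  have lim: "(\<lambda>k. vmean \<tau> f k z) \<longlonglongrightarrow> vproj \<tau> f z" if "z \<in> S" for z
    using vmean_uniformly_convergent_on_strip[OF ap \<open>\<kappa> < \<alpha>\<close>] that
    unfolding S_def uniformly_convergent_uniform_limit_iff vproj_def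
    by (rule tendsto_uniform_limitI)
  have "(\<lambda>k. vmean \<tau> f k (s + \<i> * complex_of_real \<tau>) - vmean \<tau> f k s) \<longlonglongrightarrow> 0"
  proof (rule Lim_null_comparison)
    have "cmod (vmean \<tau> f k (s + \<i> * complex_of_real \<tau>) - vmean \<tau> f k s) \<le> 2 * M / real k" for k
    proof -
      define x where "x j = vtrans (real j * \<tau>) f s" for j
      have "cmod (x n) \<le> M" for n
        unfolding x_def vtrans_def
        using \<open>s \<in> S\<close> by (intro M) (simp only: S_def strip_add_imaginary)
      then have "cmod ((\<Sum>j<k. x (1 + j)) - (\<Sum>j<k. x j)) \<le> 2 * real 1 * M"
        by (rule norm_sum_shift_le)
      moreover have "vmean \<tau> f k (s + \<i> * complex_of_real \<tau>) - vmean \<tau> f k s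
          = ((\<Sum>j<k. x (1 + j)) - (\<Sum>j<k. x j)) / of_nat k"
        by (simp add: vmean_def x_def vtrans_def diff_divide_distrib algebra_simps)
      ultimately show ?thesis
        by (simp add: norm_divide divide_right_mono)
    qed
    then show "\<forall>\<^sub>F k in sequentially.
        cmod (vmean \<tau> f k (s + \<i> * complex_of_real \<tau>) - vmean \<tau> f k s) \<le> 2 * M / real k"
      by simp
    show "(\<lambda>k. 2 * M / real k) \<longlonglongrightarrow> 0"
      by (rule lim_const_over_n)
  qed
  moreover have "(\<lambda>k. vmean \<tau> f k (s + \<i> * complex_of_real \<tau>) - vmean \<tau> f k s)
      \<longlonglongrightarrow> vproj \<tau> f (s + \<i> * complex_of_real \<tau>) - vproj \<tau> f s"
    by (intro tendsto_diff lim \<open>s \<in> S\<close> s')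
  ultimately show ?thesis
    using LIMSEQ_unique by (fastforce simp: vtrans_def)
qed

theorem theorem5:
  fixes \<kappa> \<tau> :: real and f :: "complex \<Rightarrow> complex"
  assumes "almost_periodic \<kappa> f" and "\<tau> > 0"
  shows "(\<forall>\<alpha> \<beta>. \<kappa> < \<alpha> \<and> \<alpha> < \<beta> \<longrightarrow>
            uniform_limit (strip \<alpha> \<beta>) (vmean \<tau> f) (vproj \<tau> f) sequentially) \<and>
         (\<forall>s\<in>half_plane \<kappa>. vtrans \<tau> (vproj \<tau> f) s = vproj \<tau> f s) \<and>
         vertical_period \<kappa> (vproj \<tau> f) \<tau>"
proof (intro conjI allI impI ballI)
  fix \<alpha> \<beta>
  assume "\<kappa> < \<alpha> \<and> \<alpha> < \<beta>"
  then show "uniform_limit (strip \<alpha> \<beta>) (vmean \<tau> f) (vproj \<tau> f) sequentially"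
    using vmean_uniformly_convergent_on_strip[OF assms(1)]
    unfolding uniformly_convergent_uniform_limit_iff vproj_def[abs_def] by blast
next
  show "vtrans \<tau> (vproj \<tau> f) s = vproj \<tau> f s" if "s \<in> half_plane \<kappa>" for s
    using vproj_invariant[OF assms(1) that] .
  then show "vertical_period \<kappa> (vproj \<tau> f) \<tau>"
    using assms(2) by (simp add: vertical_period_def vtrans_def)
qed

end
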